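(* Let $q\geq 3$ be an integer and let $k$ be an integer with $k\geq 94(q-1)$. Then the equation $s_q(n^2)=s_q(n)=k$ has infinitely many solutions in positive integers $n$ with $q\nmid n$ if and only if $k(k-1)\equiv 0 \pmod{q-1}$.
   Context: For an integer $q\geq 2$ and a nonnegative integer $m$, $s_q(m)$ denotes the sum of the digits of $m$ in its base-$q$ expansion. *)

theory Defs
  imports "HOL-Number_Theory.Number_Theory"
begin

definition base_digit :: "nat \<Rightarrow> nat \<Rightarrow> nat \<Rightarrow> nat" where
  "base_digit q m i = (m div q ^ i) mod q"

text \<open>
  The sum ranges over the positions of the nonzero digits. For \<open>q \<ge> 2\<close> this set is finite
  (lemma \<open>finite_nonzero_base_digits\<close>); for \<open>q \<le> 1\<close> the value carries no meaning.
\<close>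
definition digit_sum :: "nat \<Rightarrow> nat \<Rightarrow> nat" where
  "digit_sum q m = (\<Sum>i | base_digit q m i \<noteq> 0. base_digit q m i)"

lemma base_digit_eq_0:
  assumes "q \<ge> 2" and "m \<le> i"
  shows "base_digit q m i = 0"
proof -
  have "i < 2 ^ i" by (rule less_exp)
  also have "(2::nat) ^ i \<le> q ^ i" using assms(1) by (rule power_mono) simp
  finally have "m < q ^ i" using assms(2) by simp
  then show ?thesis by (simp add: base_digit_def)
qed

lemma finite_nonzero_base_digits:
  assumes "q \<ge> 2"
  shows "finite {i. base_digit q m i \<noteq> 0}"
proof (rule finite_subset)
  show "{i. base_digit q m i \<noteq> 0} \<subseteq> {..<m}"
    using base_digit_eq_0[OF assms] by (auto intro!: not_le_imp_less)
qed simp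

lemma digit_sum_eq_sum_lessThan:
  assumes "q \<ge> 2" and "\<And>i. i \<ge> L \<Longrightarrow> base_digit q m i = 0"
  shows "digit_sum q m = (\<Sum>i<L. base_digit q m i)"
  unfolding digit_sum_def
  by (rule sum.mono_neutral_left) (use assms(2) in \<open>auto intro!: not_le_imp_less\<close>)

lemma base_digit_expansion:
  assumes "\<forall>i<L. c i < q"
  shows "base_digit q (\<Sum>i<L. c i * q ^ i) j = (if j < L then c j else 0)"
  using assms
proof (induction L arbitrary: c j)
  case 0
  then show ?case by (simp add: base_digit_def)
next
  case (Suc L)
  let ?r = "\<Sum>i<L. c (Suc i) * q ^ i"
  have q: "c 0 < q" using Suc.prems by simp
  have eq: "(\<Sum>i<Suc L. c i * q ^ i) = c 0 + q * ?r"
    unfolding sum.lessThan_Suc_shift by (simp add: sum_distrib_left ac_simps)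
  have IH: "base_digit q ?r j' = (if j' < L then c (Suc j') else 0)" for j'
    using Suc.IH[of "\<lambda>i. c (Suc i)"] Suc.prems by simp
  show ?case
  proof (cases j)
    case 0
    then show ?thesis unfolding eq using q by (simp add: base_digit_def)
  next
    case (Suc j')
    have "(c 0 + q * ?r) div q ^ Suc j' = ?r div q ^ j'"
      using q by (simp add: div_mult2_eq)
    then show ?thesis using IH[of j'] Suc unfolding eq base_digit_def by simp
  qed
qed

lemma digit_sum_expansion:
  assumes "q \<ge> 2" and "\<forall>i<L. c i < q"
  shows "digit_sum q (\<Sum>i<L. c i * q ^ i) = (\<Sum>i<L. c i)"
  using digit_sum_eq_sum_lessThan[OF assms(1), of L "\<Sum>i<L. c i * q ^ i"]
  by (simp add: base_digit_expansion[OF assms(2)])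

end

theory Submission
  imports Defs
begin

text \<open>
  Necessity is the congruence \<open>s\<^sub>q(n) \<equiv> n (mod q - 1)\<close>. For sufficiency let \<open>x = q\<^sup>l\<close>, \<open>m = q\<^sup>j\<close>,
  \<open>c = b q\<^sup>u\<close> and \<open>n = A + q\<^sup>M B\<close> with \<open>A = x\<^sup>4 + m x\<^sup>3 - x\<^sup>2 + m x + 1\<close> and \<open>B = x\<^sup>2 + c x + 1\<close>.
  The negative coefficient of \<open>A\<close> contributes about \<open>l (q - 1)\<close> to \<open>s\<^sub>q(n)\<close>, whereas \<open>A\<^sup>2\<close>, \<open>2AB\<close> and
  \<open>B\<^sup>2\<close> have nonnegative coefficients as polynomials in \<open>x\<close>, so that \<open>s\<^sub>q(n\<^sup>2)\<close> does not depend on \<open>l\<close>.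
  The coefficients \<open>m\<^sup>2 - 2\<close> (twice) and \<open>4m - 2c\<close> contribute about \<open>2j (q - 1)\<close> each and
  \<open>(j - u) (q - 1)\<close>. Hence \<open>j\<close> and \<open>u\<close> adjust \<open>s\<^sub>q(n\<^sup>2)\<close> in steps of \<open>q - 1\<close>, then \<open>l\<close> adjusts
  \<open>s\<^sub>q(n)\<close>, the digit \<open>b\<close> fixes the residue modulo \<open>q - 1\<close>, and \<open>M\<close> remains free.
  Borrowing turns the coefficients of \<open>A\<close> into the base-\<open>x\<close> digits \<open>1, m, x - 1, m - 1, 1\<close>, lowest first.
\<close>

section \<open>Digit sums of concatenations, complements and differences\<close>

lemma digit_sum_0 [simp]: "digit_sum q 0 = 0"
  by (simp add: digit_sum_def base_digit_def)

lemma digit_sum_mult_base_add: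
  assumes "q \<ge> 2" and "b < q"
  shows "digit_sum q (a * q + b) = digit_sum q a + b"
proof -
  define L where "L = a * q + b"
  have "a \<le> L" using assms by (simp add: L_def trans_le_add1)
  have "base_digit q L (Suc i) = base_digit q a i" for i
    using assms by (simp add: base_digit_def L_def div_mult2_eq)
  moreover have "base_digit q L 0 = b"
    using assms by (simp add: base_digit_def L_def)
  moreover have "digit_sum q L = (\<Sum>i<Suc L. base_digit q L i)"
    using assms by (intro digit_sum_eq_sum_lessThan base_digit_eq_0) auto
  moreover have "digit_sum q a = (\<Sum>i<L. base_digit q a i)"
    using assms \<open>a \<le> L\<close> by (intro digit_sum_eq_sum_lessThan base_digit_eq_0) auto
  ultimately show ?thesis
    unfolding sum.lessThan_Suc_shift by (simp add: L_def)
qed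

lemma digit_sum_less_base:
  assumes "q \<ge> 2" and "b < q"
  shows "digit_sum q b = b"
  using digit_sum_mult_base_add[OF assms, of 0] by simp

lemma digit_sum_mult_power_add:
  assumes "q \<ge> 2" and "b < q ^ k"
  shows "digit_sum q (a * q ^ k + b) = digit_sum q a + digit_sum q b"
  using assms(2)
proof (induction k arbitrary: b)
  case (Suc k)
  have *: "b div q < q ^ k" "b mod q < q"
    using Suc.prems assms(1) by (simp_all add: less_mult_imp_div_less mult.commute)
  have "a * q ^ Suc k + b = (a * q ^ k + b div q) * q + b mod q"
    by (simp add: algebra_simps)
  moreover have "digit_sum q b = digit_sum q (b div q) + b mod q"
    using digit_sum_mult_base_add[OF assms(1) *(2), of "b div q"] by simp
  ultimately show ?case
    using digit_sum_mult_base_add[OF assms(1) *(2)] Suc.IH[OF *(1)] by simp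
qed simp

lemma digit_sum_mult_power:
  assumes "q \<ge> 2"
  shows "digit_sum q (a * q ^ k) = digit_sum q a"
  using digit_sum_mult_power_add[OF assms, of 0 k a] assms by simp

text \<open>Subtracting from k digits all equal to q - 1 never borrows, so every digit e of d,
  leading zeros included, becomes q - 1 - e.\<close>

lemma digit_sum_complement:
  assumes "q \<ge> 2" and "d < q ^ k"
  shows "digit_sum q (q ^ k - 1 - d) + digit_sum q d = k * (q - 1)"
  using assms(2)
proof (induction k arbitrary: d)
  case (Suc k)
  define e r where "e = d div q" and "r = d mod q"
  have d: "d = e * q + r" by (simp add: e_def r_def)
  have e: "e < q ^ k" and r: "r < q"
    using Suc.prems assms(1) by (simp_all add: e_def r_def less_mult_imp_div_less mult.commute)
  obtain f where f: "q ^ k = e + 1 + f" using e less_iff_Suc_add by auto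
  obtain t where t: "q = r + 1 + t" using r less_iff_Suc_add by auto
  have "q ^ Suc k = f * q + (e * q + q)" by (simp add: f algebra_simps)
  also have "\<dots> = d + 1 + (f * q + t)" using t by (simp add: d)
  finally have "q ^ Suc k - 1 - d = f * q + t" by simp
  moreover have "q ^ k - 1 - e = f" using f by simp
  ultimately show ?case
    using Suc.IH[OF e] digit_sum_mult_base_add[OF assms(1) r, of e]
      digit_sum_mult_base_add[OF assms(1), of t f] t by (simp add: d)
qed simp


lemma digit_sum_less_power:
  assumes "q \<ge> 2" and "m < q ^ k"
  shows "digit_sum q m \<le> k * (q - 1)"
  using digit_sum_complement[OF assms] by linarith

text \<open>Borrowing one unit of \<open>a\<close> leaves \<open>a - 1\<close> in front of the
  k-digit complement of \<open>c - 1\<close>. This is the source of the adjustable multiples of q -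
  1.\<close>

lemma digit_sum_mult_power_diff:
  assumes "q \<ge> 2" and "a > 0" and "0 < c" and "c \<le> q ^ k"
  shows "digit_sum q (a * q ^ k - c) + digit_sum q (c - 1) = digit_sum q (a - 1) + k * (q - 1)"
proof -
  have c: "c - 1 < q ^ k" using assms by linarith
  have "a * q ^ k = (a - 1) * q ^ k + q ^ k"
    using assms(2) by (cases a) simp_all
  then have "a * q ^ k - c = (a - 1) * q ^ k + (q ^ k - 1 - (c - 1))"
    using assms by linarith
  moreover have "q ^ k - 1 - (c - 1) < q ^ k" using assms by simp
  ultimately have "digit_sum q (a * q ^ k - c)
      = digit_sum q (a - 1) + digit_sum q (q ^ k - 1 - (c - 1))"
    using digit_sum_mult_power_add[OF assms(1)] by simp
  then show ?thesis using digit_sum_complement[OF assms(1) c] by linarith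
qed

text \<open>Coefficients below q^l occupy disjoint blocks of l digits, so no carries occur.\<close>

lemma digit_sum_horner_sum:
  assumes "q \<ge> 2" and "\<forall>d\<in>set ds. d < q ^ l"
  shows "digit_sum q (horner_sum id (q ^ l) ds) = (\<Sum>d\<leftarrow>ds. digit_sum q d)"
  using assms(2)
proof (induction ds)
  case (Cons d ds)
  then show ?case
    using digit_sum_mult_power_add[OF assms(1), of d l "horner_sum id (q ^ l) ds"]
    by (simp add: ac_simps id_def)
qed simp

lemma cong_digit_sum:
  assumes "q \<ge> 2"
  shows "[digit_sum q m = m] (mod (q - 1))"
proof (induction m rule: less_induct)
  case (less m)
  show ?case
  proof (cases "m = 0")
    case False
    have "m div q < m" using False assms by simp
    \<comment> \<open>The factor 1 is written out so that the next link can replace it by q.\<close>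
    then have "[digit_sum q (m div q) + m mod q = m div q * 1 + m mod q] (mod (q - 1))"
      by (simp only: mult_1_right) (intro cong_add less.IH cong_refl)
    also have "[1 = q] (mod (q - 1))"
      using cong_altdef_nat[of 1 q "q - 1"] assms by (simp add: cong_sym_eq)
    then have "[m div q * 1 + m mod q = m div q * q + m mod q] (mod (q - 1))"
      by (intro cong_add cong_mult cong_refl)
    also have "m div q * q + m mod q = m" by simp
    also have "digit_sum q (m div q) + m mod q = digit_sum q m"
      using digit_sum_mult_base_add[OF assms, of "m mod q" "m div q"] assms by simp
    finally show ?thesis .
  qed simp
qed

section \<open>The pair A, B and the family built from it\<close>

lemma square_horner_sum:
  fixes m x :: nat
  assumes "m \<ge> 2" and "x \<ge> 1"
  shows "(horner_sum id x [1, m, x - 1, m - 1, 1])\<^sup>2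
    = horner_sum id x [1, 2 * m, m\<^sup>2 - 2, 0, 2 * m\<^sup>2 + 3, 0, m\<^sup>2 - 2, 2 * m, 1]"
proof -
  \<comment> \<open>Passing to integers removes truncated subtraction. With A = x^4 + m x^3 - x^2 +
    m x + 1, the terms 2m and -2m cancel at x^3 and x^5.\<close>
  have "m\<^sup>2 \<ge> 2" using power_mono[OF assms(1), of 2] by simp
  then have "int (m\<^sup>2 - 2) = int m ^ 2 - 2" "int (x - 1) = int x - 1" "int (m - 1) = int m - 1"
    using assms by (simp_all add: of_nat_diff)
  then have "int ((horner_sum id x [1, m, x - 1, m - 1, 1])\<^sup>2)
      = int (horner_sum id x [1, 2 * m, m\<^sup>2 - 2, 0, 2 * m\<^sup>2 + 3, 0, m\<^sup>2 - 2, 2 * m, 1])"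
    by (simp only: horner_sum_simps id_apply of_nat_add of_nat_mult of_nat_power of_nat_0 of_nat_1
        of_nat_numeral)
      (simp add: algebra_simps power2_eq_square)
  then show ?thesis by (simp only: of_nat_eq_iff)
qed

text \<open>The coefficient -1 of A is cancelled by a product 1 * 1 at x^2 and x^4. At x^3 it leaves
  4m - 2c, which is nonnegative because c \<le> m.\<close>

lemma mult_horner_sum:
  fixes m x c :: nat
  assumes "m \<ge> 2" and "x \<ge> 1" and "c \<le> m"
  shows "2 * horner_sum id x [1, m, x - 1, m - 1, 1] * horner_sum id x [1, c, 1]
    = horner_sum id x [2, 2 * m + 2 * c, 2 * m * c, 4 * m - 2 * c, 2 * m * c, 2 * m + 2 * c, 2]"
proof -
  have "int (4 * m - 2 * c) = 4 * int m - 2 * int c" "int (x - 1) = int x - 1"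
    "int (m - 1) = int m - 1"
    using assms by (simp_all add: of_nat_diff)
  then have "int (2 * horner_sum id x [1, m, x - 1, m - 1, 1] * horner_sum id x [1, c, 1])
    = int (horner_sum id x [2, 2 * m + 2 * c, 2 * m * c, 4 * m - 2 * c, 2 * m * c, 2 * m + 2 * c, 2])"
    by (simp only: horner_sum_simps id_apply of_nat_add of_nat_mult of_nat_0 of_nat_1
        of_nat_numeral)
      (simp add: algebra_simps power2_eq_square)
  then show ?thesis by (simp only: of_nat_eq_iff)
qed

text \<open>Each negative term costs one borrow, so j, l and v enter linearly. The term for
  \<open>2 * b - 1\<close> stands on the left because the borrow in 4m - 2c complements it.
  \<open>digit_sum q 3\<close> stays unevaluated: it is 1 for q = 3.\<close>

lemma digit_sums_of_pair:
  fixes q b u v j l :: nat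
  defines "A \<equiv> horner_sum id (q ^ l) [1, q ^ j, q ^ l - 1, q ^ j - 1, 1]"
    and "B \<equiv> horner_sum id (q ^ l) [1, b * q ^ u, 1]"
  assumes q: "q \<ge> 3" and b: "0 < b" "b < q" and u: "u \<ge> 1" and v: "v \<ge> 2"
    and j: "j = u + v" and l: "l \<ge> 2 * j + 2"
  shows "digit_sum q A + digit_sum q B = 5 + b + (j + l) * (q - 1)"
    and "digit_sum q (A\<^sup>2) + digit_sum q (2 * A * B) + digit_sum q (B\<^sup>2) + digit_sum q (2 * b - 1)
      = 18 + 2 * digit_sum q 3 + 6 * digit_sum q (2 * b) + digit_sum q (b\<^sup>2) + (4 * j + v) * (q - 1)"
proof -
  define x m c where "x = q ^ l" and "m = q ^ j" and "c = b * q ^ u"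
  have q2: "q \<ge> 2" using q by simp
  have q9: "(9::nat) \<le> q ^ 2" using power_mono[OF q, of 2] by simp
  also have "q ^ 2 \<le> m" unfolding m_def using q v j by (intro power_increasing) auto
  finally have m9: "m \<ge> 9" .
  \<comment> \<open>The 2 in l \<ge> 2j + 2 yields the factor 9, enough room for every coefficient
    of A^2, 2AB and B^2 to lie below x.\<close>
  from q9 have "m\<^sup>2 * 9 \<le> q ^ (2 * j) * q ^ 2"
    unfolding m_def power_mult[symmetric] by (simp add: mult.commute)
  also have "\<dots> \<le> x"
    unfolding x_def power_add[symmetric] using q l by (intro power_increasing) auto
  finally have x: "m\<^sup>2 * 9 \<le> x" .
  have mm: "m * 9 \<le> m\<^sup>2" using m9 by (simp add: power2_eq_square)
  have qv: "q * q \<le> q ^ v"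
    using power_increasing[of 2 v q] q v by (simp add: power2_eq_square)
  have "2 * b < 3 * q" using b by simp
  also have "3 * q \<le> q * q" using q by simp
  finally have b2: "2 * b < q * q" .
  with qv have b2v: "2 * b < q ^ v" by simp
  have m: "m = q ^ u * q ^ v" by (simp add: m_def j power_add)
  \<comment> \<open>This is what v \<ge> 2 provides; it keeps 2m + 2c free of carries.\<close>
  have cm: "2 * c < m"
  proof -
    have "2 * b * q ^ u < q ^ v * q ^ u" using b2v q by (intro mult_strict_right_mono) auto
    then show ?thesis by (simp add: m c_def mult.commute mult.left_commute)
  qed
  have mc: "2 * (m * c) \<le> m\<^sup>2" using cm by (simp add: power2_eq_square)
  have cc: "c\<^sup>2 \<le> m\<^sup>2" using cm by (intro power_mono) auto
  have bounds: "1 < x" "m < x" "x - 1 < x" "m - 1 < x" "2 * m < x" "m\<^sup>2 - 2 < x" "0 < x"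
    "2 * m\<^sup>2 + 3 < x" "2 < x" "2 * m + 2 * c < x" "2 * m * c < x" "4 * m - 2 * c < x"
    "c < x" "2 * c < x" "c\<^sup>2 + 2 < x"
    using m9 x mm cm mc cc by linarith+
  note small = digit_sum_less_base[OF q2]
  have s1: "digit_sum q 1 = 1" and s2: "digit_sum q 2 = 2" and sb: "digit_sum q b = b"
    using q b by (simp_all add: small)
  have s1': "digit_sum q (Suc 0) = 1" using s1 by simp
  have sm: "digit_sum q m = 1"
    using digit_sum_mult_power[OF q2, of 1 j] s1 by (simp add: m_def)
  have sm1: "digit_sum q (m - 1) = j * (q - 1)"
    using digit_sum_complement[OF q2, of 0 j] q by (simp add: m_def)
  have sx1: "digit_sum q (x - 1) = l * (q - 1)"
    using digit_sum_complement[OF q2, of 0 l] q by (simp add: x_def)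
  have s2m: "digit_sum q (2 * m) = 2"
    using digit_sum_mult_power[OF q2, of 2 j] s2 by (simp add: m_def)
  have m2: "m\<^sup>2 = q ^ (2 * j)" by (simp add: m_def power_even_eq)
  have smm: "digit_sum q (m\<^sup>2 - 2) + 1 = 2 * j * (q - 1)"
    using digit_sum_mult_power_diff[OF q2, of 1 2 "2 * j"] s1 m9 mm by (simp add: m2)
  have smm3: "digit_sum q (2 * m\<^sup>2 + 3) = 2 + digit_sum q 3"
    using digit_sum_mult_power_add[OF q2, of 3 "2 * j" 2] s2 m9 mm by (simp add: m2)
  have sc: "digit_sum q c = b" "digit_sum q (2 * c) = digit_sum q (2 * b)"
    using digit_sum_mult_power[OF q2, of b u] digit_sum_mult_power[OF q2, of "2 * b" u] sb
    by (simp_all add: c_def mult.assoc)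
  have smc: "digit_sum q (2 * m + 2 * c) = 2 + digit_sum q (2 * b)"
    using digit_sum_mult_power_add[OF q2, of "2 * c" j 2] s2 sc cm by (simp add: m_def)
  have smc2: "digit_sum q (2 * m * c) = digit_sum q (2 * b)"
    using digit_sum_mult_power[OF q2, of "2 * c" j] sc by (simp add: m_def ac_simps)
  \<comment> \<open>Taking out q^u confines the borrow to exactly v digits.\<close>
  have "4 * m - 2 * c = (4 * q ^ v - 2 * b) * q ^ u"
    unfolding m c_def diff_mult_distrib by (simp only: ac_simps)
  then have smc4: "digit_sum q (4 * m - 2 * c) + digit_sum q (2 * b - 1)
      = digit_sum q 3 + v * (q - 1)"
    using digit_sum_mult_power_diff[OF q2, of 4 "2 * b" v] b b2v
    by (simp add: digit_sum_mult_power[OF q2])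
  have "2 < q ^ (2 * u)"
    using power_increasing[of 1 "2 * u" q] q u by simp
  then have scc: "digit_sum q (c\<^sup>2 + 2) = digit_sum q (b\<^sup>2) + 2"
    using digit_sum_mult_power_add[OF q2, of 2 "2 * u" "b\<^sup>2"] s2
    by (simp add: c_def power_mult_distrib power_even_eq)
  note horner = digit_sum_horner_sum[OF q2, of _ l, folded x_def]
  have A: "A = horner_sum id x [1, m, x - 1, m - 1, 1]" and B: "B = horner_sum id x [1, c, 1]"
    by (simp_all only: A_def B_def x_def m_def c_def)
  have "\<forall>d\<in>set [1, m, x - 1, m - 1, 1]. d < x"
    using bounds by (simp only: list.set ball_simps insert_iff)
  then have "digit_sum q A = (\<Sum>d\<leftarrow>[1, m, x - 1, m - 1, 1]. digit_sum q d)"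
    unfolding A by (rule horner)
  then have "digit_sum q A = 3 + (j + l) * (q - 1)"
    by (simp only: list.map sum_list.Cons sum_list.Nil s1 sm sx1 sm1 add_mult_distrib)
  moreover have "\<forall>d\<in>set [1, c, 1]. d < x"
    using bounds by (simp only: list.set ball_simps insert_iff)
  then have "digit_sum q B = (\<Sum>d\<leftarrow>[1, c, 1]. digit_sum q d)"
    unfolding B by (rule horner)
  then have "digit_sum q B = 2 + b" by (simp add: s1' sc)
  ultimately show "digit_sum q A + digit_sum q B = 5 + b + (j + l) * (q - 1)" by simp
  let ?AA = "[1, 2 * m, m\<^sup>2 - 2, 0, 2 * m\<^sup>2 + 3, 0, m\<^sup>2 - 2, 2 * m, 1]"
    and ?AB = "[2, 2 * m + 2 * c, 2 * m * c, 4 * m - 2 * c, 2 * m * c, 2 * m + 2 * c, 2]"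
    and ?BB = "[1, 2 * c, c\<^sup>2 + 2, 2 * c, 1]"
  have AA: "A\<^sup>2 = horner_sum id x ?AA"
    unfolding A using m9 bounds(1) by (intro square_horner_sum) linarith+
  have "\<forall>d\<in>set ?AA. d < x" using bounds by (simp only: list.set ball_simps insert_iff)
  then have "digit_sum q (A\<^sup>2) = (\<Sum>d\<leftarrow>?AA. digit_sum q d)"
    unfolding AA by (rule horner)
  then have "digit_sum q (A\<^sup>2) = 6 + digit_sum q 3 + 2 * (digit_sum q (m\<^sup>2 - 2) + 1)"
    by (simp add: s1' s2m smm3)
  then have sAA: "digit_sum q (A\<^sup>2) = 6 + digit_sum q 3 + 4 * j * (q - 1)"
    unfolding smm by linarith
  have AB: "2 * A * B = horner_sum id x ?AB"
    unfolding A B using m9 bounds(1) cm by (intro mult_horner_sum) linarith+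
  have "\<forall>d\<in>set ?AB. d < x" using bounds by (simp only: list.set ball_simps insert_iff)
  then have "digit_sum q (2 * A * B) = (\<Sum>d\<leftarrow>?AB. digit_sum q d)"
    unfolding AB by (rule horner)
  then have "digit_sum q (2 * A * B) = 8 + 4 * digit_sum q (2 * b) + digit_sum q (4 * m - 2 * c)"
    by (simp add: s2 smc smc2)
  then have sAB: "digit_sum q (2 * A * B) + digit_sum q (2 * b - 1)
      = 8 + digit_sum q 3 + 4 * digit_sum q (2 * b) + v * (q - 1)"
    using smc4 by linarith
  have BB: "B\<^sup>2 = horner_sum id x ?BB"
    unfolding B by (simp add: algebra_simps power2_eq_square)
  have "\<forall>d\<in>set ?BB. d < x" using bounds by (simp only: list.set ball_simps insert_iff)
  then have "digit_sum q (B\<^sup>2) = (\<Sum>d\<leftarrow>?BB. digit_sum q d)"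
    unfolding BB by (rule horner)
  then have sBB: "digit_sum q (B\<^sup>2) = 4 + 2 * digit_sum q (2 * b) + digit_sum q (b\<^sup>2)"
    using sc scc by (simp add: s1')
  show "digit_sum q (A\<^sup>2) + digit_sum q (2 * A * B) + digit_sum q (B\<^sup>2)
      + digit_sum q (2 * b - 1) = 18 + 2 * digit_sum q 3 + 6 * digit_sum q (2 * b)
      + digit_sum q (b\<^sup>2) + (4 * j + v) * (q - 1)"
    using sAA sAB sBB unfolding add_mult_distrib by linarith
qed

text \<open>For large M the blocks A and B of n = A + q^M B do not overlap, nor do the blocks A^2,
  2AB and B^2 of its square. The last digit of n is that of A.\<close>

lemma infinite_digit_sum_shifts:
  fixes q A B k :: nat
  assumes q: "q \<ge> 2" and A: "\<not> q dvd A" and B: "B > 0"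
    and s: "digit_sum q A + digit_sum q B = k"
    and s2: "digit_sum q (A\<^sup>2) + digit_sum q (2 * A * B) + digit_sum q (B\<^sup>2) = k"
  shows "infinite {n. n > 0 \<and> \<not> q dvd n \<and> digit_sum q (n ^ 2) = k \<and> digit_sum q n = k}"
    (is "infinite ?S")
proof -
  define K where "K = A\<^sup>2 + 2 * A * B"
  define f where "f M = B * q ^ M + A" for M
  have "f M \<in> ?S" if "M > K" for M
  proof -
    have "M < q ^ M" by (rule less_le_trans[OF less_exp power_mono]) (use q in auto)
    with that have *: "A\<^sup>2 < q ^ M" "2 * A * B < q ^ M" by (simp_all add: K_def)
    have "A \<le> A\<^sup>2" by (simp add: power2_eq_square)
    then have "A < q ^ M" using *(1) by simp
    then have "digit_sum q (f M) = k"
      using digit_sum_mult_power_add[OF q] s by (simp add: f_def)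
    moreover have "(f M)\<^sup>2 = (B\<^sup>2 * q ^ M + 2 * A * B) * q ^ M + A\<^sup>2"
      by (simp add: f_def power2_eq_square algebra_simps)
    then have "digit_sum q ((f M)\<^sup>2) = k"
      using digit_sum_mult_power_add[OF q *(1)] digit_sum_mult_power_add[OF q *(2)] s2 by simp
    moreover have "q dvd B * q ^ M" using that by (simp add: dvd_power)
    then have "\<not> q dvd f M" using A by (simp add: f_def dvd_add_right_iff)
    moreover from this have "f M > 0" using gr0I by fastforce
    ultimately show ?thesis by simp
  qed
  then have "f ` {K<..} \<subseteq> ?S" by blast
  moreover have "inj f" using q B by (auto simp: inj_def f_def)
  then have "infinite (f ` {K<..})"
    by (simp add: finite_image_iff inj_on_subset infinite_Ioi)
  ultimately show ?thesis using infinite_super by blast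
qed

section \<open>The equivalence: necessity, then the choice of b, j, u and l\<close>

theorem theorem1p5:
  fixes q k :: nat
  assumes "q \<ge> 3" and "k \<ge> 94 * (q - 1)"
  shows "infinite {n :: nat. n > 0 \<and> \<not> q dvd n \<and> digit_sum q (n ^ 2) = k \<and> digit_sum q n = k}
    \<longleftrightarrow> [k * (k - 1) = 0] (mod (q - 1))"
proof
  assume "infinite {n :: nat. n > 0 \<and> \<not> q dvd n \<and> digit_sum q (n ^ 2) = k \<and> digit_sum q n = k}"
  then obtain n where n: "digit_sum q (n ^ 2) = k" "digit_sum q n = k"
    using not_finite_existsD by blast
  have "[k = n ^ 2] (mod (q - 1))" "[k = n] (mod (q - 1))"
    using cong_digit_sum[of q n] cong_digit_sum[of q "n ^ 2"] n assms(1) by simp_all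
  then have "[k * k = k] (mod (q - 1))"
    by (metis cong_mult cong_sym cong_trans power2_eq_square)
  then show "[k * (k - 1) = 0] (mod (q - 1))"
    using cong_altdef_nat[of k "k * k" "q - 1"] by (cases k) (auto simp: cong_0_iff algebra_simps)
next
  assume k: "[k * (k - 1) = 0] (mod (q - 1))"
  define p where "p = q - 1"
  have q2: "q \<ge> 2" and p: "p \<ge> 2" and q: "q = p + 1" using assms(1) by (auto simp: p_def)
  have kp: "k \<ge> 94 * p" using assms(2) by (simp add: p_def)
  \<comment> \<open>The representative of k - 5 modulo p in 1..p, since the digit sums of A and B
    total 5 + b plus a multiple of p.\<close>
  define b where "b = (k - 6) mod p + 1"
  have b: "0 < b" "b < q" "b \<le> p"
    using p by (simp_all add: b_def q Suc_le_eq)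
  have k1: "k - (5 + b) = (k - 6) div p * p"
    using kp p by (simp add: b_def minus_mod_eq_div_mult[symmetric])
  have kb: "[k = 5 + b] (mod p)"
    using k1 kp p b by (simp add: cong_altdef_nat)
  \<comment> \<open>The square condition becomes k + d = N + Y p with Y = 4j + v.\<close>
  define N where "N = 18 + 2 * digit_sum q 3 + 6 * digit_sum q (2 * b) + digit_sum q (b\<^sup>2)"
  define d where "d = digit_sum q (2 * b - 1)"
  have qq: "3 * q \<le> q * q" using assms(1) by simp
  have le2: "digit_sum q m \<le> 2 * p" if "m < q * q" for m
    using digit_sum_less_power[OF q2, of m 2] that by (simp add: power2_eq_square p_def)
  have bb: "b\<^sup>2 < q * q" using b by (simp add: power2_eq_square mult_strict_mono)
  \<comment> \<open>All arguments have at most two digits, so N \<le> 18 + 18p, and 18 \<le>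
    9p.\<close>
  have "N \<le> 27 * p" "d \<le> 2 * p"
    using le2[of 3] le2[of "2 * b"] le2[of "b\<^sup>2"] le2[of "2 * b - 1"] bb qq b p assms(1)
    unfolding N_def d_def by linarith+
  have cong: "[digit_sum q m = m] (mod p)" for m
    using cong_digit_sum[OF q2] by (simp add: p_def)
  have "[k + k * (k - 1) = k + 0] (mod p)"
    using k by (intro cong_add cong_refl) (simp add: p_def)
  moreover have "k + k * (k - 1) = k * k" by (cases k) simp_all
  ultimately have "[k = k * k] (mod p)" by (simp add: cong_sym)
  moreover have "[k * k = (5 + b) * (5 + b)] (mod p)" by (intro cong_mult kb)
  ultimately have "[k + d = (5 + b) * (5 + b) + (2 * b - 1)] (mod p)"
    unfolding d_def by (intro cong_add cong) (rule cong_trans)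
  \<comment> \<open>The right side is N with each digit sum replaced by its argument, to which it is
    congruent.\<close>
  also have "(5 + b) * (5 + b) + (2 * b - 1) = 18 + 2 * 3 + 6 * (2 * b) + b\<^sup>2"
    using b by (simp add: algebra_simps power2_eq_square)
  also have "[18 + 2 * 3 + 6 * (2 * b) + b\<^sup>2 = N] (mod p)"
    unfolding N_def by (intro cong_add cong_mult cong_refl cong_sym[OF cong])
  finally have "[k + d = N] (mod p)" .
  moreover have "N \<le> k + d" using \<open>N \<le> 27 * p\<close> kp by linarith
  ultimately obtain Y where Y: "k + d = N + Y * p"
    by (metis cong_le_nat add.commute)
  \<comment> \<open>Here 67 = 94 - 27. It gives j \<ge> 16 below, enough for u \<ge> 1 and l \<ge>
    2j + 2.\<close>
  have "Y \<ge> 67"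
  proof (rule ccontr)
    assume "\<not> Y \<ge> 67"
    then have "Y * p \<le> 66 * p" by (intro mult_le_mono1) simp
    then show False using Y kp p \<open>N \<le> 27 * p\<close> by linarith
  qed
  \<comment> \<open>The shift by 2 places the remainder v in 2..5 instead of 0..3.\<close>
  define j where "j = (Y - 2) div 4"
  define v where "v = Y - 4 * j"
  have v: "2 \<le> v" "v \<le> 5" "Y = 4 * j + v" using \<open>Y \<ge> 67\<close> by (auto simp: j_def v_def)
  define u where "u = j - v"
  have u: "u \<ge> 1" "j = u + v" using v \<open>Y \<ge> 67\<close> by (auto simp: u_def)
  define K where "K = (k - 6) div p"
  have K: "k = 5 + b + K * p" using k1 kp p b by (simp add: K_def)
  \<comment> \<open>Comparing both expressions for k bounds K below by 4j + v - 6, hence by 3j + 2,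
    so l = K - j is large enough.\<close>
  have "Y * p \<le> 2 * p + (5 + b + K * p)" using Y K \<open>d \<le> 2 * p\<close> by linarith
  also have "\<dots> \<le> (K + 6) * p" using b p by (simp add: algebra_simps)
  finally have "Y \<le> K + 6" using p by simp
  define l where "l = K - j"
  have "K = j + l" "l \<ge> 2 * j + 2"
    using \<open>Y \<le> K + 6\<close> \<open>Y \<ge> 67\<close> v by (auto simp: l_def)
  then have l: "l \<ge> 2 * j + 2" "k = 5 + b + (j + l) * p" using K by simp_all
  note sums = digit_sums_of_pair[OF assms(1) b(1,2) u(1) v(1) u(2) l(1)]
  show "infinite {n :: nat. n > 0 \<and> \<not> q dvd n \<and> digit_sum q (n ^ 2) = k \<and> digit_sum q n = k}"
  proof (rule infinite_digit_sum_shifts[OF q2])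
    let ?A = "horner_sum id (q ^ l) [1, q ^ j, q ^ l - 1, q ^ j - 1, 1]"
    let ?B = "horner_sum id (q ^ l) [1, b * q ^ u, 1]"
    \<comment> \<open>As l > 0, all of A except its constant coefficient 1 is divisible by
      q.\<close>
    have "q dvd q ^ l * h" for h using l by (simp add: dvd_power)
    then have "q dvd ?A \<longleftrightarrow> q dvd 1"
      by (simp only: horner_sum_simps dvd_add_left_iff id_apply)
    then show "\<not> q dvd ?A" using q2 by simp
    show "?B > 0" by simp
    show "digit_sum q ?A + digit_sum q ?B = k" using sums(1) l by (simp add: p_def)
    show "digit_sum q (?A\<^sup>2) + digit_sum q (2 * ?A * ?B) + digit_sum q (?B\<^sup>2) = k"
      using sums(2) Y v(3) by (simp only: N_def d_def p_def)
  qed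
qed

end
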